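(* Let $n \ge 1$ and let $a_1 \le a_2 \le \dots \le a_n$ be integers with $\sum_{i=1}^n a_i = 1$. Let \[ L = \Bigl\{ \lambda=(\lambda_1,\dots,\lambda_n) \in \mathbb{Z}_{\ge 0}^n : \sum_{j=1}^n a_j \lambda_{\pi(j)} \ge 0 \text{ for all } \pi \in S_n \Bigr\} \] and $F(z_1,\dots,z_n) = \sum_{\lambda \in L} z_1^{\lambda_1} z_2^{\lambda_2}\cdots z_n^{\lambda_n}$. For $1 \le i,j \le n$ define \[ b_{i,j} = \begin{cases} 1 & \text{if } j = n,\\ -(a_1+\dots+a_j) & \text{if } n \ge i > j \ge 1,\\ 1-(a_1+\dots+a_j) & \text{if } 1 \le i \le j < n. \end{cases} \] Then \[ F(z_1,\dots,z_n) = \sum_{\pi \in S_n} \frac{\prod_{j \in D_\pi} \bigl(z_{\pi(1)}^{b_{1,j}} z_{\pi(2)}^{b_{2,j}} \cdots z_{\pi(n)}^{b_{n,j}}\bigr)}{\prod_{j=1}^n \bigl(1 - z_{\pi(1)}^{b_{1,j}} z_{\pi(2)}^{b_{2,j}} \cdots z_{\pi(n)}^{b_{n,j}}\bigr)}. \] In particular, $F(q) := F(q,q,\dots,q)$ satisfies \[ F(q) = \frac{\sum_{\pi \in S_n} \prod_{j \in D_\pi} q^{\,j - n\sum_{i=1}^j a_i}}{(1-q^n)\prod_{j=1}^{n-1}\bigl(1 - q^{\,j - n\sum_{i=1}^j a_i}\bigr)}. \]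
   Context: $S_n$ is the symmetric group on $[n]=\{1,\dots,n\}$, a permutation written as $\pi=\pi(1)\pi(2)\cdots\pi(n)$. The descent set of $\pi$ is $D_\pi = \{ j \in \{1,\dots,n-1\} : \pi(j) > \pi(j+1)\}$. Generating functions are formal power series. *)

theory Defs
  imports
    "HOL-Library.Poly_Mapping"
    "HOL-Combinatorics.Permutations"
    "HOL-Computational_Algebra.Formal_Power_Series"
begin

section \<open>Multivariate formal power series\<close>

text \<open>
  Formal power series with coefficients in \<open>'a\<close> and variables indexed by \<open>'v\<close>.
  An exponent vector is a finitely supported function \<open>'v \<Rightarrow>\<^sub>0 nat\<close>; coefficients are
  unrestricted. The ring of series in \<open>z\<^sub>1, \<dots>, z\<^sub>n\<close> consists of the series over
  \<open>'v = nat\<close> supported on exponent vectors with \<open>keys\<close> contained in \<open>{1..n}\<close>.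
\<close>

typedef ('v, 'a) mfps = "UNIV :: (('v \<Rightarrow>\<^sub>0 nat) \<Rightarrow> 'a) set"
  morphisms mfps_coeff Abs_mfps
  by simp

setup_lifting type_definition_mfps

lemma mfps_eqI: "(\<And>m. mfps_coeff f m = mfps_coeff g m) \<Longrightarrow> f = g"
  by transfer auto

lemma mfps_coeff_Abs [simp]: "mfps_coeff (Abs_mfps c) m = c m"
  by (simp add: Abs_mfps_inverse)

lemma finite_exponents_below:
  fixes m :: "'v \<Rightarrow>\<^sub>0 nat"
  shows "finite {s. \<forall>k. Poly_Mapping.lookup s k \<le> Poly_Mapping.lookup m k}"
proof -
  let ?A = "{s. \<forall>k. Poly_Mapping.lookup s k \<le> Poly_Mapping.lookup m k}"
  let ?r = "\<lambda>s. restrict (Poly_Mapping.lookup s) (Poly_Mapping.keys m)"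
  have "?r ` ?A \<subseteq> (\<Pi>\<^sub>E k\<in>Poly_Mapping.keys m. {..Poly_Mapping.lookup m k})"
    by auto
  then have fin: "finite (?r ` ?A)"
    by (rule finite_subset) (intro finite_PiE, simp_all)
  have "inj_on ?r ?A"
  proof (rule inj_onI)
    fix s t assume s: "s \<in> ?A" and t: "t \<in> ?A" and eq: "?r s = ?r t"
    show "s = t"
    proof (rule poly_mapping_eqI)
      fix k
      show "Poly_Mapping.lookup s k = Poly_Mapping.lookup t k"
      proof (cases "k \<in> Poly_Mapping.keys m")
        case True
        then show ?thesis using fun_cong[OF eq, of k] by simp
      next
        case False
        then have "Poly_Mapping.lookup m k = 0" by (simp add: in_keys_iff)
        moreover have "Poly_Mapping.lookup s k \<le> Poly_Mapping.lookup m k"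
          "Poly_Mapping.lookup t k \<le> Poly_Mapping.lookup m k"
          using s t by auto
        ultimately show ?thesis by simp
      qed
    qed
  qed
  with fin show ?thesis by (rule finite_imageD)
qed

definition exponent_splits :: "('v \<Rightarrow>\<^sub>0 nat) \<Rightarrow> (('v \<Rightarrow>\<^sub>0 nat) \<times> ('v \<Rightarrow>\<^sub>0 nat)) set"
  where "exponent_splits m = {(s, t). s + t = m}"

lemma finite_exponent_splits [simp]: "finite (exponent_splits m)"
proof (rule finite_subset)
  let ?A = "{s. \<forall>k. Poly_Mapping.lookup s k \<le> Poly_Mapping.lookup m k}"
  show "exponent_splits m \<subseteq> ?A \<times> ?A"
    by (auto simp: exponent_splits_def lookup_add)
  show "finite (?A \<times> ?A)"
    by (intro finite_cartesian_product finite_exponents_below)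
qed

instantiation mfps :: (type, comm_ring_1) comm_ring_1
begin

definition "0 = Abs_mfps (\<lambda>_. 0)"
definition "1 = Abs_mfps (\<lambda>m. if m = 0 then 1 else 0)"
definition "f + g = Abs_mfps (\<lambda>m. mfps_coeff f m + mfps_coeff g m)"
definition "f - g = Abs_mfps (\<lambda>m. mfps_coeff f m - mfps_coeff g m)"
definition "- f = Abs_mfps (\<lambda>m. - mfps_coeff f m)"
definition "f * g = Abs_mfps (\<lambda>m. \<Sum>(s, t)\<in>exponent_splits m. mfps_coeff f s * mfps_coeff g t)"

lemma mfps_mult_assoc: "(f * g) * h = f * (g * h)" for f g h :: "('a, 'b) mfps"
proof (rule mfps_eqI)
  fix m
  let ?f = "mfps_coeff f" and ?g = "mfps_coeff g" and ?h = "mfps_coeff h"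
  have "mfps_coeff ((f * g) * h) m =
      (\<Sum>p\<in>exponent_splits m. \<Sum>q\<in>exponent_splits (fst p).
        ?f (fst q) * ?g (snd q) * ?h (snd p))"
    by (simp add: times_mfps_def case_prod_beta sum_distrib_right)
  also have "\<dots> = (\<Sum>x\<in>Sigma (exponent_splits m) (\<lambda>p. exponent_splits (fst p)).
        ?f (fst (snd x)) * ?g (snd (snd x)) * ?h (snd (fst x)))"
    by (subst sum.Sigma) (auto simp: case_prod_beta)
  also have "\<dots> = (\<Sum>x\<in>Sigma (exponent_splits m) (\<lambda>p. exponent_splits (snd p)).
        ?f (fst (fst x)) * (?g (fst (snd x)) * ?h (snd (snd x))))"
    by (rule sum.reindex_bij_witness[where
          i = "\<lambda>((r, u), (s, t)). ((r + s, t), (r, s))" and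
          j = "\<lambda>((u, t), (r, s)). ((r, s + t), (s, t))"])
      (auto simp: exponent_splits_def ac_simps)
  also have "\<dots> = (\<Sum>p\<in>exponent_splits m. \<Sum>q\<in>exponent_splits (snd p).
        ?f (fst p) * (?g (fst q) * ?h (snd q)))"
    by (subst sum.Sigma) (auto simp: case_prod_beta)
  also have "\<dots> = mfps_coeff (f * (g * h)) m"
    by (simp add: times_mfps_def case_prod_beta sum_distrib_left)
  finally show "mfps_coeff ((f * g) * h) m = mfps_coeff (f * (g * h)) m" .
qed

lemma mfps_mult_commute: "f * g = g * f" for f g :: "('a, 'b) mfps"
proof (rule mfps_eqI)
  fix m
  show "mfps_coeff (f * g) m = mfps_coeff (g * f) m"
    unfolding times_mfps_def mfps_coeff_Abs
    by (rule sum.reindex_bij_witness[where i = prod.swap and j = prod.swap])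
      (auto simp: exponent_splits_def ac_simps)
qed

lemma mfps_mult_1: "1 * f = f" for f :: "('a, 'b) mfps"
proof (rule mfps_eqI)
  fix m
  have "mfps_coeff (1 * f) m =
      (\<Sum>p\<in>exponent_splits m. (if fst p = 0 then 1 else 0) * mfps_coeff f (snd p))"
    by (simp add: times_mfps_def one_mfps_def case_prod_beta)
  also have "\<dots> = (\<Sum>p\<in>{(0 :: 'a \<Rightarrow>\<^sub>0 nat, m)}.
      (if fst p = 0 then 1 else 0) * mfps_coeff f (snd p))"
    by (rule sum.mono_neutral_right[OF finite_exponent_splits])
      (auto simp: exponent_splits_def)
  finally show "mfps_coeff (1 * f) m = mfps_coeff f m" by simp
qed

instance
proof
  fix f g h :: "('a, 'b) mfps"
  show "f * g * h = f * (g * h)" by (rule mfps_mult_assoc)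
  show "f * g = g * f" by (rule mfps_mult_commute)
  show "1 * f = f" by (rule mfps_mult_1)
  show "(f + g) * h = f * h + g * h"
    by (rule mfps_eqI)
      (simp add: times_mfps_def plus_mfps_def case_prod_beta distrib_right sum.distrib)
  show "(0 :: ('a, 'b) mfps) \<noteq> 1"
  proof
    assume "(0 :: ('a, 'b) mfps) = 1"
    then have "mfps_coeff (0 :: ('a, 'b) mfps) 0 = mfps_coeff 1 0" by simp
    then show False by (simp add: zero_mfps_def one_mfps_def)
  qed
qed (rule mfps_eqI; simp add: plus_mfps_def zero_mfps_def uminus_mfps_def
      minus_mfps_def add_ac)+

end

text \<open>
  Units have their true inverse; the value for non-units is \<open>0\<close> by convention.
\<close>

instantiation mfps :: (type, comm_ring_1) inverse
begin

definition "inverse f = (if \<exists>g. f * g = 1 then THE g. f * g = 1 else 0)" for f :: "('a, 'b) mfps"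
definition "f div g = f * inverse g" for f g :: "('a, 'b) mfps"

instance ..

end

lemma mfps_inverse_unique:
  fixes f g :: "('v, 'a :: comm_ring_1) mfps"
  assumes "f * g = 1"
  shows "inverse f = g"
proof -
  have uniq: "h = g" if "f * h = 1" for h
  proof -
    have "h = h * (f * g)" by (simp add: assms)
    also have "\<dots> = (f * h) * g" by (simp add: mult_ac)
    finally show ?thesis using that by simp
  qed
  have "(THE g. f * g = 1) = g"
    by (rule the_equality) (fact assms, fact uniq)
  moreover have "\<exists>g. f * g = 1"
    using assms by blast
  ultimately show ?thesis
    by (simp only: inverse_mfps_def if_True)
qed

definition mfps_var :: "'v \<Rightarrow> ('v, 'a :: comm_ring_1) mfps"
  where "mfps_var v = Abs_mfps (\<lambda>m. if m = Poly_Mapping.single v 1 then 1 else 0)"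

text \<open>
  The formal infinite sum of the monomials \<open>z\<^sup>m\<close>, \<open>m \<in> M\<close>: every monomial occurs at most
  once, so the coefficients are those of the indicator function of \<open>M\<close>.
\<close>

definition mfps_of_exponents :: "('v \<Rightarrow>\<^sub>0 nat) set \<Rightarrow> ('v, 'a :: comm_ring_1) mfps"
  where "mfps_of_exponents M = Abs_mfps (\<lambda>m. if m \<in> M then 1 else 0)"

text \<open>
  The substitution \<open>f(q, \<dots>, q)\<close> in a series \<open>f\<close> in the variables \<open>z\<^sub>1, \<dots>, z\<^sub>n\<close>: the
  coefficient of \<open>q\<^sup>k\<close> collects the finitely many monomials of total degree \<open>k\<close>.
\<close>

definition mfps_diagonal :: "nat \<Rightarrow> (nat, 'a :: comm_ring_1) mfps \<Rightarrow> 'a fps"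
  where "mfps_diagonal n f =
    Abs_fps (\<lambda>k. \<Sum>m | Poly_Mapping.keys m \<subseteq> {1..n} \<and>
      (\<Sum>i=1..n. Poly_Mapping.lookup m i) = k. mfps_coeff f m)"

lemma finite_exponents_of_degree:
  fixes n k :: nat
  shows "finite {m. Poly_Mapping.keys m \<subseteq> {1..n} \<and> (\<Sum>i=1..n. Poly_Mapping.lookup m i) = k}"
  (is "finite ?M")
proof (rule finite_subset)
  let ?d = "\<Sum>i=1..n. Poly_Mapping.single i k"
  have d: "Poly_Mapping.lookup ?d j = (if j \<in> {1..n} then k else 0)" for j
    by (simp add: lookup_sum lookup_single when_def)
  show "?M \<subseteq> {m. \<forall>j. Poly_Mapping.lookup m j \<le> Poly_Mapping.lookup ?d j}"
  proof (intro subsetI CollectI allI)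
    fix m j
    assume m: "m \<in> ?M"
    show "Poly_Mapping.lookup m j \<le> Poly_Mapping.lookup ?d j"
    proof (cases "j \<in> {1..n}")
      case True
      then have "Poly_Mapping.lookup m j \<le> (\<Sum>i=1..n. Poly_Mapping.lookup m i)"
        by (intro member_le_sum) auto
      with True m d show ?thesis by simp
    next
      case False
      with m have "Poly_Mapping.lookup m j = 0" by (auto simp: in_keys_iff)
      then show ?thesis by simp
    qed
  qed
  show "finite {m. \<forall>j. Poly_Mapping.lookup m j \<le> Poly_Mapping.lookup ?d j}"
    by (rule finite_exponents_below)
qed


section \<open>Nonnegative vectors under permuted linear constraints\<close>

definition descent_set :: "nat \<Rightarrow> (nat \<Rightarrow> nat) \<Rightarrow> nat set"
  where "descent_set n \<pi> = {j \<in> {1..<n}. \<pi> j > \<pi> (j + 1)}"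

definition constraint_set :: "nat \<Rightarrow> (nat \<Rightarrow> int) \<Rightarrow> (nat \<Rightarrow>\<^sub>0 nat) set"
  where "constraint_set n a = {l. Poly_Mapping.keys l \<subseteq> {1..n} \<and>
    (\<forall>\<pi>. \<pi> permutes {1..n} \<longrightarrow> (\<Sum>j=1..n. a j * int (Poly_Mapping.lookup l (\<pi> j))) \<ge> 0)}"

definition F_series :: "nat \<Rightarrow> (nat \<Rightarrow> int) \<Rightarrow> (nat, 'a :: comm_ring_1) mfps"
  where "F_series n a = mfps_of_exponents (constraint_set n a)"

definition b_entry :: "nat \<Rightarrow> (nat \<Rightarrow> int) \<Rightarrow> nat \<Rightarrow> nat \<Rightarrow> int"
  where "b_entry n a i j =
    (if j = n then 1
     else if i > j then - (\<Sum>k=1..j. a k)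
     else 1 - (\<Sum>k=1..j. a k))"

text \<open>
  By \<open>b_entry_nonneg\<close> and \<open>q_exponent_pos\<close> below, the conversion \<open>nat\<close> never
  truncates an exponent.
\<close>

lemma partial_sum_nonpos:
  fixes a :: "nat \<Rightarrow> int"
  assumes mono: "mono_on {1..n} a" and total: "(\<Sum>i=1..n. a i) = 1" and j: "j < n"
  shows "(\<Sum>k=1..j. a k) \<le> 0"
proof (rule ccontr)
  assume "\<not> ?thesis"
  then have pos: "(\<Sum>k=1..j. a k) \<ge> 1" by simp
  have "\<exists>k\<in>{1..j}. a k \<ge> 1"
  proof (rule ccontr)
    assume "\<not> (\<exists>k\<in>{1..j}. a k \<ge> 1)"
    then have "(\<Sum>k=1..j. a k) \<le> 0" by (intro sum_nonpos) force
    with pos show False by simp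
  qed
  then obtain k where k: "k \<in> {1..j}" "a k \<ge> 1" by blast
  have "a i \<ge> 1" if "i \<in> {j+1..n}" for i
    using mono_onD[OF mono, of k i] k that j by fastforce
  then have "(\<Sum>i=j+1..n. a i) \<ge> (\<Sum>i=j+1..n. 1)"
    by (intro sum_mono) auto
  moreover have "(\<Sum>i=j+1..n. (1::int)) \<ge> 1" using j by simp
  moreover have "(\<Sum>i=1..n. a i) = (\<Sum>i=1..j. a i) + (\<Sum>i=j+1..n. a i)"
    using j sum.ub_add_nat[of 1 j a "n - j"] by simp
  ultimately show False using pos total by linarith
qed

lemma b_entry_nonneg:
  assumes "mono_on {1..n} a" "(\<Sum>i=1..n. a i) = 1" "j \<le> n"
  shows "b_entry n a i j \<ge> 0"
  using partial_sum_nonpos[OF assms(1,2), of j] assms(3) by (auto simp: b_entry_def)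

definition z_monomial ::
    "nat \<Rightarrow> (nat \<Rightarrow> int) \<Rightarrow> (nat \<Rightarrow> nat) \<Rightarrow> nat \<Rightarrow> (nat, 'a :: comm_ring_1) mfps"
  where "z_monomial n a \<pi> j = (\<Prod>i=1..n. mfps_var (\<pi> i) ^ nat (b_entry n a i j))"

definition q_exponent :: "nat \<Rightarrow> (nat \<Rightarrow> int) \<Rightarrow> nat \<Rightarrow> int"
  where "q_exponent n a j = int j - int n * (\<Sum>i=1..j. a i)"

lemma q_exponent_pos:
  assumes "mono_on {1..n} a" "(\<Sum>i=1..n. a i) = 1" "1 \<le> j" "j < n"
  shows "q_exponent n a j > 0"
proof -
  have "int n * (\<Sum>i=1..j. a i) \<le> 0"
    using partial_sum_nonpos[OF assms(1,2,4)] by (intro mult_nonneg_nonpos) auto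
  with assms(3) show ?thesis unfolding q_exponent_def by linarith
qed

end

theory Submission
  imports Defs
begin

text \<open>
  The set \<open>L\<close> is a disjoint union of free simplicial cones indexed by permutations: \<open>\<lambda>\<close> lies in
  the cone of the unique \<open>\<pi>\<close> that lists the indices by decreasing \<open>\<lambda>\<close>-value, ties being broken by
  increasing index, so that \<open>\<lambda>\<close> strictly drops at the descents of \<open>\<pi>\<close>. The columns of \<open>b\<close> are the
  generators of this cone: \<open>\<lambda>\<^bsub>\<pi>(i)\<^esub> = \<Sum>\<^sub>j c\<^sub>j b\<^bsub>i,j\<^esub>\<close> holds iff \<open>c\<^sub>j = \<lambda>\<^bsub>\<pi>(j)\<^esub> - \<lambda>\<^bsub>\<pi>(j+1)\<^esub>\<close> for \<open>j < n\<close> and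
  \<open>c\<^sub>n = \<Sum>\<^sub>j a\<^sub>j \<lambda>\<^bsub>\<pi>(j)\<^esub>\<close>. As \<open>a\<close> is increasing, the constraint for this \<open>\<pi>\<close> is the strongest one.
  The generating function of a free cone is a product of geometric series, and the
  one-variable formula follows because \<open>f \<mapsto> f(q, \<dots>, q)\<close> is a ring homomorphism.
\<close>

section \<open>Indicator series of sets of exponents\<close>

text \<open>Exponents are cancellative, so the only split of \<open>m\<close> with second part
  \<open>e\<close> is \<open>(m - e, e)\<close>. Hence every coefficient of the product is
  \<open>0\<close> or \<open>1\<close>, and multiplying by a monomial translates the set.\<close>

lemma mfps_of_exponents_times_monom:
  "mfps_of_exponents M * mfps_of_exponents {e} =
     (mfps_of_exponents ((+) e ` M) :: ('v, 'a :: comm_ring_1) mfps)"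
proof (rule mfps_eqI)
  fix m :: "'v \<Rightarrow>\<^sub>0 nat"
  have "mfps_coeff (mfps_of_exponents M * mfps_of_exponents {e} :: ('v, 'a) mfps) m =
      (\<Sum>p\<in>exponent_splits m. if fst p \<in> M \<and> snd p = e then 1 else 0)"
    unfolding times_mfps_def mfps_of_exponents_def mfps_coeff_Abs
    by (rule sum.cong) auto
  also have "\<dots> = (\<Sum>p\<in>{p \<in> exponent_splits m. fst p \<in> M \<and> snd p = e}. 1)"
    by (rule sum.inter_filter[symmetric]) simp
  also have "{p \<in> exponent_splits m. fst p \<in> M \<and> snd p = e} =
      (if m \<in> (+) e ` M then {(m - e, e)} else {})"
    by (auto simp: exponent_splits_def add.commute)
  finally show "mfps_coeff (mfps_of_exponents M * mfps_of_exponents {e} :: ('v, 'a) mfps) m =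
      mfps_coeff (mfps_of_exponents ((+) e ` M)) m"
    by (simp add: mfps_of_exponents_def)
qed

lemma mfps_one_eq_monom: "1 = mfps_of_exponents {0}"
  by (simp add: one_mfps_def mfps_of_exponents_def)

lemma mfps_monom_mult:
  "mfps_of_exponents {d} * mfps_of_exponents {e} =
     (mfps_of_exponents {d + e} :: ('v, 'a :: comm_ring_1) mfps)"
  by (simp add: mfps_of_exponents_times_monom add.commute)

lemma mfps_var_power:
  "mfps_var v ^ k = (mfps_of_exponents {Poly_Mapping.single v k} :: ('v, 'a :: comm_ring_1) mfps)"
proof (induction k)
  case 0
  then show ?case by (simp add: mfps_one_eq_monom)
next
  case (Suc k)
  have "mfps_var v = (mfps_of_exponents {Poly_Mapping.single v 1} :: ('v, 'a) mfps)"
    by (simp add: mfps_var_def mfps_of_exponents_def)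
  with Suc show ?case
    by (simp add: mfps_monom_mult flip: single_add)
qed

lemma prod_mfps_monom:
  "(\<Prod>i\<in>I. mfps_of_exponents {e i}) = mfps_of_exponents {\<Sum>i\<in>I. e i}"
  by (induction I rule: infinite_finite_induct) (simp_all add: mfps_one_eq_monom mfps_monom_mult)

lemma mfps_of_exponents_diff:
  assumes "N \<subseteq> M"
  shows "mfps_of_exponents M - mfps_of_exponents N = mfps_of_exponents (M - N)"
  using assms by (intro mfps_eqI) (auto simp: minus_mfps_def mfps_of_exponents_def)

lemma mfps_of_exponents_Un_disjoint:
  assumes "M \<inter> N = {}"
  shows "mfps_of_exponents (M \<union> N) = mfps_of_exponents M + mfps_of_exponents N"
  using assms by (intro mfps_eqI) (auto simp: plus_mfps_def mfps_of_exponents_def)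

lemma mfps_of_exponents_UN_disjoint:
  assumes "finite P" "disjoint_family_on C P"
  shows "mfps_of_exponents (\<Union>p\<in>P. C p) = (\<Sum>p\<in>P. mfps_of_exponents (C p))"
  using assms
proof (induction P rule: finite_induct)
  case empty
  then show ?case by (simp add: mfps_of_exponents_def zero_mfps_def)
next
  case (insert p P)
  have "C p \<inter> C q = {}" if "q \<in> P" for q
    using insert.prems insert.hyps that by (intro disjoint_family_onD[OF insert.prems]) auto
  then have "C p \<inter> (\<Union>q\<in>P. C q) = {}" by blast
  moreover have "disjoint_family_on C P"
    using insert.prems by (rule disjoint_family_on_mono[rotated]) blast
  ultimately show ?case using insert by (simp add: mfps_of_exponents_Un_disjoint)
qed


section \<open>Free cones\<close>

text \<open>The coefficient of every generator indexed by \<open>D\<close> is required to be positive.\<close>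

definition half_open_cone ::
    "'i set \<Rightarrow> 'i set \<Rightarrow> ('i \<Rightarrow> ('v \<Rightarrow>\<^sub>0 nat)) \<Rightarrow> ('v \<Rightarrow>\<^sub>0 nat) set"
  where "half_open_cone D I e = {m. \<exists>c. (\<forall>j\<in>I \<inter> D. 1 \<le> c j) \<and>
    (\<forall>k. Poly_Mapping.lookup m k = (\<Sum>j\<in>I. c j * Poly_Mapping.lookup (e j) k))}"

text \<open>For finite \<open>I\<close> this is linear independence over the integers: an integer
  relation splits into its positive and negative parts, which are two combinations with natural
  coefficients.\<close>

definition free_generators :: "'i set \<Rightarrow> ('i \<Rightarrow> ('v \<Rightarrow>\<^sub>0 nat)) \<Rightarrow> bool"
  where "free_generators I e \<longleftrightarrow> (\<forall>c d :: 'i \<Rightarrow> nat.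
    (\<forall>k. (\<Sum>j\<in>I. c j * Poly_Mapping.lookup (e j) k) = (\<Sum>j\<in>I. d j * Poly_Mapping.lookup (e j) k)) \<longrightarrow>
    (\<forall>j\<in>I. c j = d j))"

lemma half_open_coneI:
  assumes "\<And>j. j \<in> I \<Longrightarrow> j \<in> D \<Longrightarrow> 1 \<le> c j"
    and "\<And>k. Poly_Mapping.lookup m k = (\<Sum>j\<in>I. c j * Poly_Mapping.lookup (e j) k)"
  shows "m \<in> half_open_cone D I e"
  unfolding half_open_cone_def using assms by blast

lemma half_open_coneE:
  assumes "m \<in> half_open_cone D I e"
  obtains c where "\<And>j. j \<in> I \<Longrightarrow> j \<in> D \<Longrightarrow> 1 \<le> c j"
    and "\<And>k. Poly_Mapping.lookup m k = (\<Sum>j\<in>I. c j * Poly_Mapping.lookup (e j) k)"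
  using assms unfolding half_open_cone_def by blast

lemma free_generatorsD:
  assumes "free_generators I e"
    and "\<And>k. (\<Sum>j\<in>I. c j * Poly_Mapping.lookup (e j) k) =
      (\<Sum>j\<in>I. d j * Poly_Mapping.lookup (e j) k)"
    and "j \<in> I"
  shows "c j = d j"
  using assms unfolding free_generators_def by blast

text \<open>A combination over \<open>I\<close> extends to \<open>insert k I\<close> by the
  coefficient \<open>0\<close> at \<open>k\<close>.\<close>

lemma free_generators_insertD:
  assumes "free_generators (insert k I) e" "finite I" "k \<notin> I"
  shows "free_generators I e"
  unfolding free_generators_def
proof (intro allI impI ballI)
  fix c d :: "'a \<Rightarrow> nat" and j
  assume eq: "\<forall>x. (\<Sum>j\<in>I. c j * Poly_Mapping.lookup (e j) x) =
      (\<Sum>j\<in>I. d j * Poly_Mapping.lookup (e j) x)" and j: "j \<in> I"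
  have ext: "(\<Sum>j\<in>insert k I. (f(k := 0)) j * Poly_Mapping.lookup (e j) x) =
      (\<Sum>j\<in>I. f j * Poly_Mapping.lookup (e j) x)" for f :: "'a \<Rightarrow> nat" and x
    using assms(2,3) by (auto intro!: sum.cong)
  have "(c(k := 0)) j = (d(k := 0)) j"
    using free_generatorsD[OF assms(1), of "c(k := 0)" "d(k := 0)" j] eq j
    by (simp only: ext) simp
  with j assms(3) show "c j = d j" by (auto split: if_splits)
qed

text \<open>
  Removing a translate of the cone along one generator leaves the facet in which the
  coefficient of this generator is minimal.
\<close>

lemma half_open_cone_insert_diff:
  assumes free: "free_generators (insert k I) e" and I: "finite I" "k \<notin> I"
  shows "half_open_cone D (insert k I) e - (+) (e k) ` half_open_cone D (insert k I) e =
    (if k \<in> D then (+) (e k) ` half_open_cone D I e else half_open_cone D I e)"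
    (is "?S' - (+) (e k) ` ?S' = ?R")
proof (intro equalityI subsetI)
  fix m assume "m \<in> ?S' - (+) (e k) ` ?S'"
  then have m: "m \<in> ?S'" and notin: "m \<notin> (+) (e k) ` ?S'" by auto
  from m obtain c where c: "\<And>j. j \<in> insert k I \<Longrightarrow> j \<in> D \<Longrightarrow> 1 \<le> c j"
    and lm: "\<And>x. Poly_Mapping.lookup m x =
      (\<Sum>j\<in>insert k I. c j * Poly_Mapping.lookup (e j) x)"
    by (rule half_open_coneE) blast
  have lm': "Poly_Mapping.lookup m x = c k * Poly_Mapping.lookup (e k) x +
      (\<Sum>j\<in>I. c j * Poly_Mapping.lookup (e j) x)" for x
    using lm I by simp
  \<comment> \<open>Subtraction of exponents truncates at \<open>0\<close>. It is exact here because
    \<open>e k\<close> occurs in the combination that represents \<open>m\<close>.\<close>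
  have shift: "m = e k + (m - e k)" if "c k \<ge> 1"
  proof (rule poly_mapping_eqI)
    fix x
    have "Poly_Mapping.lookup (e k) x \<le> Poly_Mapping.lookup m x"
      using that lm'[of x] by (cases "c k") auto
    then show "Poly_Mapping.lookup m x = Poly_Mapping.lookup (e k + (m - e k)) x"
      by (simp add: lookup_add lookup_minus)
  qed
  have upd: "(\<Sum>j\<in>I. (c(k := c k - 1)) j * Poly_Mapping.lookup (e j) x) =
      (\<Sum>j\<in>I. c j * Poly_Mapping.lookup (e j) x)" for x
    using I by (intro sum.cong) auto
  have lmin: "Poly_Mapping.lookup (m - e k) x =
      (\<Sum>j\<in>insert k I. (c(k := c k - 1)) j * Poly_Mapping.lookup (e j) x)" if "c k \<ge> 1" for x
    unfolding sum.insert[OF I] upd using that by (cases "c k") (auto simp: lookup_minus lm')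
  \<comment> \<open>With a larger coefficient at \<open>k\<close>, lowering it by one would stay
    admissible and place \<open>m\<close> in the translate.\<close>
  have ck: "c k \<le> (if k \<in> D then 1 else 0)"
  proof (rule ccontr)
    assume "\<not> ?thesis"
    then have gt: "c k > (if k \<in> D then 1 else 0)" by simp
    then have ge: "c k \<ge> 1" by (auto split: if_splits)
    have "m - e k \<in> ?S'"
    proof (rule half_open_coneI[where c = "c(k := c k - 1)"])
      show "1 \<le> (c(k := c k - 1)) j" if "j \<in> insert k I" "j \<in> D" for j
        using that c[of j] gt by (auto split: if_splits)
    qed (rule lmin[OF ge])
    with shift[OF ge] notin show False by (metis imageI)
  qed
  show "m \<in> ?R"
  proof (cases "k \<in> D")
    case True
    then have "c k = 1" using ck c[of k] by simp
    then have "m - e k \<in> half_open_cone D I e"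
      using c by (intro half_open_coneI[where c = c]) (auto simp: lookup_minus lm')
    with True shift \<open>c k = 1\<close> show ?thesis by (metis imageI order_refl)
  next
    case False
    then have "c k = 0" using ck by simp
    with False c show ?thesis by (auto intro!: half_open_coneI[where c = c] simp: lm')
  qed
next
  fix m assume "m \<in> ?R"
  \<comment> \<open>Both cases of the right-hand side take one form: a combination over
    \<open>insert k I\<close> whose coefficient at \<open>k\<close> has its least admissible
    value.\<close>
  then have "\<exists>c. (\<forall>j\<in>I. j \<in> D \<longrightarrow> 1 \<le> c j) \<and> c k = (if k \<in> D then 1 else 0) \<and>
    (\<forall>x. Poly_Mapping.lookup m x = (\<Sum>j\<in>insert k I. c j * Poly_Mapping.lookup (e j) x))"
  proof -
    obtain m' where m': "m' \<in> half_open_cone D I e" "m = (if k \<in> D then e k + m' else m')"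
      using \<open>m \<in> ?R\<close> by (auto split: if_splits)
    from m'(1) obtain c where c: "\<And>j. j \<in> I \<Longrightarrow> j \<in> D \<Longrightarrow> 1 \<le> c j"
      and lm: "\<And>x. Poly_Mapping.lookup m' x = (\<Sum>j\<in>I. c j * Poly_Mapping.lookup (e j) x)"
      by (rule half_open_coneE) blast
    let ?c = "c(k := if k \<in> D then 1 else 0)"
    have upd: "(\<Sum>j\<in>I. ?c j * Poly_Mapping.lookup (e j) x) =
        (\<Sum>j\<in>I. c j * Poly_Mapping.lookup (e j) x)" for x
      using I by (intro sum.cong) auto
    show ?thesis
      unfolding sum.insert[OF I]
      by (rule exI[of _ ?c], unfold upd) (use c I m'(2) lm in \<open>auto simp: lookup_add\<close>)
  qed
  then obtain c where c: "\<And>j. j \<in> I \<Longrightarrow> j \<in> D \<Longrightarrow> 1 \<le> c j" "c k = (if k \<in> D then 1 else 0)"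
    and lm: "\<And>x. Poly_Mapping.lookup m x =
      (\<Sum>j\<in>insert k I. c j * Poly_Mapping.lookup (e j) x)"
    by blast
  have "m \<in> ?S'"
    using c lm by (intro half_open_coneI[where c = c]) auto
  moreover have "m \<notin> (+) (e k) ` ?S'"
  proof
    assume "m \<in> (+) (e k) ` ?S'"
    then obtain m' where m': "m' \<in> ?S'" "m = e k + m'" by blast
    from m'(1) obtain d where d: "\<And>j. j \<in> insert k I \<Longrightarrow> j \<in> D \<Longrightarrow> 1 \<le> d j"
      and lm': "\<And>x. Poly_Mapping.lookup m' x =
        (\<Sum>j\<in>insert k I. d j * Poly_Mapping.lookup (e j) x)"
      by (rule half_open_coneE) blast
    let ?d = "d(k := Suc (d k))"
    have upd: "(\<Sum>j\<in>I. ?d j * Poly_Mapping.lookup (e j) x) =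
        (\<Sum>j\<in>I. d j * Poly_Mapping.lookup (e j) x)" for x
      using I by (intro sum.cong) auto
    have "Poly_Mapping.lookup m x = (\<Sum>j\<in>insert k I. ?d j * Poly_Mapping.lookup (e j) x)" for x
      unfolding sum.insert[OF I] upd using I by (simp add: m'(2) lookup_add lm')
    \<comment> \<open>By freeness the two representations agree at \<open>k\<close>, but the
      coefficient from the translate exceeds the least admissible value by at least one.\<close>
    then have "c k = ?d k"
      using lm by (intro free_generatorsD[OF free, of c ?d k]) (simp only:, simp)
    with c(2) d[of k] show False by (auto split: if_splits)
  qed
  ultimately show "m \<in> ?S' - (+) (e k) ` ?S'" by blast
qed

text \<open>Raising one coefficient preserves the positivity conditions. The inclusion turns the
  difference of the two indicator series into the series of the set difference.\<close>

lemma half_open_cone_translate: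
  assumes I: "finite I" "k \<in> I"
  shows "(+) (e k) ` half_open_cone D I e \<subseteq> half_open_cone D I e"
proof (rule image_subsetI)
  fix m assume "m \<in> half_open_cone D I e"
  then obtain c where c: "\<And>j. j \<in> I \<Longrightarrow> j \<in> D \<Longrightarrow> 1 \<le> c j"
    and lm: "\<And>x. Poly_Mapping.lookup m x = (\<Sum>j\<in>I. c j * Poly_Mapping.lookup (e j) x)"
    by (rule half_open_coneE) blast
  show "e k + m \<in> half_open_cone D I e"
  proof (rule half_open_coneI[where c = "\<lambda>j. (if j = k then 1 else 0) + c j"])
    show "1 \<le> (if j = k then 1 else 0) + c j" if "j \<in> I" "j \<in> D" for j
      using c[OF that] by simp
    have "(\<Sum>j\<in>I. (if j = k then 1 else 0) * Poly_Mapping.lookup (e j) x) =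
        (\<Sum>j\<in>I. if j = k then Poly_Mapping.lookup (e j) x else 0)" for x
      by (rule sum.cong) auto
    then show "Poly_Mapping.lookup (e k + m) x =
        (\<Sum>j\<in>I. ((if j = k then 1 else 0) + c j) * Poly_Mapping.lookup (e j) x)" for x
      using I by (simp add: lookup_add lm distrib_right sum.distrib)
  qed
qed

text \<open>Induction on the generators: the factor for \<open>k\<close> subtracts the translate
  along \<open>e k\<close>. What remains is the cone on the other generators, shifted by
  \<open>e k\<close> exactly when \<open>k\<close> lies in \<open>D\<close>, which contributes the
  factor for \<open>k\<close> on the right.\<close>

lemma half_open_cone_series_mult:
  assumes "finite I" "free_generators I e"
  shows "mfps_of_exponents (half_open_cone D I e) * (\<Prod>j\<in>I. 1 - mfps_of_exponents {e j}) =
    (\<Prod>j\<in>I \<inter> D. mfps_of_exponents {e j} :: ('v, 'a :: comm_ring_1) mfps)"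
  using assms
proof (induction I rule: finite_induct)
  case empty
  have "half_open_cone D {} e = {0}"
    by (auto simp: half_open_cone_def intro: poly_mapping_eqI)
  then show ?case by (simp add: mfps_one_eq_monom mfps_monom_mult)
next
  case (insert k I)
  let ?S' = "half_open_cone D (insert k I) e" and ?S = "half_open_cone D I e"
  let ?z = "\<lambda>j. mfps_of_exponents {e j} :: ('v, 'a) mfps"
  have "mfps_of_exponents ?S' * (1 - ?z k) =
      mfps_of_exponents ?S' - mfps_of_exponents ((+) (e k) ` ?S')"
    by (simp add: right_diff_distrib mfps_of_exponents_times_monom)
  also have "\<dots> = mfps_of_exponents (?S' - (+) (e k) ` ?S')"
    using insert.hyps by (intro mfps_of_exponents_diff half_open_cone_translate) auto
  also have "\<dots> = mfps_of_exponents ?S * (if k \<in> D then ?z k else 1)"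
    using half_open_cone_insert_diff[OF insert.prems insert.hyps(1,2), of D]
    by (simp add: mfps_of_exponents_times_monom)
  finally have step: "mfps_of_exponents ?S' * (1 - ?z k) =
      mfps_of_exponents ?S * (if k \<in> D then ?z k else 1)" .
  have "mfps_of_exponents ?S' * (\<Prod>j\<in>insert k I. 1 - ?z j) =
      (mfps_of_exponents ?S' * (1 - ?z k)) * (\<Prod>j\<in>I. 1 - ?z j)"
    using insert.hyps by (simp add: mult.assoc)
  also have "\<dots> = (if k \<in> D then ?z k else 1) *
      (mfps_of_exponents ?S * (\<Prod>j\<in>I. 1 - ?z j))"
    unfolding step by (simp only: mult_ac)
  also have "\<dots> = (if k \<in> D then ?z k else 1) * (\<Prod>j\<in>I \<inter> D. ?z j)"
    using insert.IH free_generators_insertD[OF insert.prems insert.hyps(1,2)] by simp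
  also have "\<dots> = (\<Prod>j\<in>insert k I \<inter> D. ?z j)"
    using insert.hyps by (auto simp: Int_insert_left)
  finally show ?case .
qed

text \<open>The cone without positivity conditions has a series inverse to the denominator. So the
  denominator is a unit and the quotient is a true one, not the default value \<open>0\<close>; the
  second claim later carries the quotient through the substitution.\<close>

lemma half_open_cone_series:
  fixes e :: "'i \<Rightarrow> ('v \<Rightarrow>\<^sub>0 nat)"
  assumes "finite I" "free_generators I e" "D \<subseteq> I"
  shows "mfps_of_exponents (half_open_cone D I e) =
    (\<Prod>j\<in>D. mfps_of_exponents {e j}) /
    (\<Prod>j\<in>I. 1 - mfps_of_exponents {e j} :: ('v, 'a :: comm_ring_1) mfps)" (is "?F = ?N / ?P")
    and "\<exists>h. (\<Prod>j\<in>I. 1 - mfps_of_exponents {e j} :: ('v, 'a :: comm_ring_1) mfps) * h = 1"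
proof -
  let ?G = "mfps_of_exponents (half_open_cone {} I e) :: ('v, 'a) mfps"
  have G: "?P * ?G = 1"
    using half_open_cone_series_mult[OF assms(1,2), of "{}"] by (simp add: mult.commute)
  then show "\<exists>h. ?P * h = 1" by blast
  have "?F * ?P = ?N"
    using half_open_cone_series_mult[OF assms(1,2), of D] assms(3) by (simp add: Int_absorb1)
  then have "?N / ?P = ?F * ?P * ?G"
    using mfps_inverse_unique[OF G] by (simp only: divide_mfps_def)
  then show "?F = ?N / ?P" using G by (simp add: mult.assoc)
qed


section \<open>The substitution of one variable for all\<close>

text \<open>Both coefficients sum over the pairs \<open>(s, t)\<close> of exponents in the variables
  \<open>1..n\<close> with total degree \<open>k\<close>. The left side groups them by
  \<open>s + t\<close>, the right side by the degree of \<open>s\<close>.\<close>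

lemma mfps_diagonal_mult:
  "mfps_diagonal n (f * g) = mfps_diagonal n f * mfps_diagonal n g"
proof (rule fps_ext)
  fix k
  define S where "S = {1..n}"
  define M where "M d = {m :: nat \<Rightarrow>\<^sub>0 nat. Poly_Mapping.keys m \<subseteq> S \<and>
    (\<Sum>i\<in>S. Poly_Mapping.lookup m i) = d}" for d
  have fin: "finite (M d)" for d
    unfolding M_def S_def by (rule finite_exponents_of_degree)
  \<comment> \<open>Natural exponents cannot cancel, so \<open>s + t\<close> uses only the variables
    in \<open>S\<close> iff both \<open>s\<close> and \<open>t\<close> do.\<close>
  have keys: "Poly_Mapping.keys (s + t) = Poly_Mapping.keys s \<union> Poly_Mapping.keys t"
    for s t :: "nat \<Rightarrow>\<^sub>0 nat"
    by (auto simp: in_keys_iff lookup_add)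
  have coeff: "fps_nth (mfps_diagonal n h) d = (\<Sum>m\<in>M d. mfps_coeff h m)" for h :: "(nat, 'a) mfps" and d
    by (simp add: mfps_diagonal_def M_def S_def)
  have "fps_nth (mfps_diagonal n (f * g)) k =
      (\<Sum>m\<in>M k. \<Sum>p\<in>exponent_splits m. mfps_coeff f (fst p) * mfps_coeff g (snd p))"
    by (simp add: coeff times_mfps_def case_prod_beta)
  also have "\<dots> = (\<Sum>x\<in>Sigma (M k) exponent_splits.
      mfps_coeff f (fst (snd x)) * mfps_coeff g (snd (snd x)))"
    by (subst sum.Sigma) (auto simp: fin case_prod_beta)
  also have "\<dots> = (\<Sum>x\<in>Sigma {0..k} (\<lambda>d. M d \<times> M (k - d)).
      mfps_coeff f (fst (snd x)) * mfps_coeff g (snd (snd x)))"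
    by (rule sum.reindex_bij_witness[where
          i = "\<lambda>(d, (s, t)). (s + t, (s, t))" and
          j = "\<lambda>(m, (s, t)). (\<Sum>i\<in>S. Poly_Mapping.lookup s i, (s, t))"])
      (auto simp: exponent_splits_def M_def keys lookup_add sum.distrib subset_iff)
  also have "\<dots> = (\<Sum>d=0..k. \<Sum>p\<in>M d \<times> M (k - d). mfps_coeff f (fst p) * mfps_coeff g (snd p))"
    by (subst sum.Sigma) (auto simp: fin case_prod_beta)
  also have "\<dots> = (\<Sum>d=0..k. (\<Sum>s\<in>M d. mfps_coeff f s) * (\<Sum>t\<in>M (k - d). mfps_coeff g t))"
    by (simp add: sum_product sum.cartesian_product case_prod_beta)
  also have "\<dots> = fps_nth (mfps_diagonal n f * mfps_diagonal n g) k"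
    by (simp add: fps_mult_nth coeff)
  finally show "fps_nth (mfps_diagonal n (f * g)) k =
      fps_nth (mfps_diagonal n f * mfps_diagonal n g) k" .
qed

text \<open>The condition on the support matters: \<open>mfps_diagonal\<close> discards monomials
  with a variable outside \<open>{1..n}\<close>.\<close>

lemma mfps_diagonal_monom:
  assumes "Poly_Mapping.keys e \<subseteq> {1..n}"
  shows "mfps_diagonal n (mfps_of_exponents {e}) = fps_X ^ (\<Sum>i=1..n. Poly_Mapping.lookup e i)"
proof (rule fps_ext)
  fix k
  show "fps_nth (mfps_diagonal n (mfps_of_exponents {e})) k =
      fps_nth (fps_X ^ (\<Sum>i=1..n. Poly_Mapping.lookup e i) :: 'a fps) k"
    using assms finite_exponents_of_degree[of n k]
    by (auto simp: mfps_diagonal_def mfps_of_exponents_def fps_X_power_nth)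
qed

lemma mfps_diagonal_one: "mfps_diagonal n 1 = 1"
  by (simp add: mfps_one_eq_monom mfps_diagonal_monom)

lemma mfps_diagonal_diff:
  "mfps_diagonal n (f - g) = mfps_diagonal n f - mfps_diagonal n g"
  by (rule fps_ext) (simp add: mfps_diagonal_def minus_mfps_def sum_subtractf)

lemma mfps_diagonal_add:
  "mfps_diagonal n (f + g) = mfps_diagonal n f + mfps_diagonal n g"
  by (rule fps_ext) (simp add: mfps_diagonal_def plus_mfps_def sum.distrib)

lemma mfps_diagonal_zero: "mfps_diagonal n 0 = 0"
  by (rule fps_ext) (simp add: mfps_diagonal_def zero_mfps_def)

lemma mfps_diagonal_sum:
  "mfps_diagonal n (\<Sum>i\<in>I. f i) = (\<Sum>i\<in>I. mfps_diagonal n (f i))"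
  by (induction I rule: infinite_finite_induct)
    (simp_all add: mfps_diagonal_zero mfps_diagonal_add)

lemma mfps_diagonal_prod:
  "mfps_diagonal n (\<Prod>i\<in>I. f i) = (\<Prod>i\<in>I. mfps_diagonal n (f i))"
  by (induction I rule: infinite_finite_induct)
    (simp_all add: mfps_diagonal_one mfps_diagonal_mult)

lemma fps_nth_0_prod: "fps_nth (\<Prod>i\<in>I. f i) 0 = (\<Prod>i\<in>I. fps_nth (f i :: 'a :: comm_ring_1 fps) 0)"
  by (induction I rule: infinite_finite_induct) simp_all

text \<open>A multiplicative map sends the unit \<open>g\<close> to a unit, and the quotient by a
  unit is determined by its product with that unit.\<close>

lemma mfps_diagonal_divide:
  fixes f g :: "(nat, 'a :: field) mfps"
  assumes "\<exists>h. g * h = 1"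
  shows "mfps_diagonal n (f / g) = mfps_diagonal n f / mfps_diagonal n g"
proof -
  obtain h where h: "g * h = 1" using assms by blast
  have "mfps_diagonal n g * mfps_diagonal n h = 1"
    using h by (simp add: mfps_diagonal_one flip: mfps_diagonal_mult)
  then have "is_unit (mfps_diagonal n g)" by (metis dvdI)
  moreover have "mfps_diagonal n (f / g) * mfps_diagonal n g = mfps_diagonal n f"
    using mfps_inverse_unique[OF h] h
    by (simp add: divide_mfps_def mult_ac flip: mfps_diagonal_mult)
  ultimately show ?thesis
    by (metis dvd_0_left nonzero_mult_div_cancel_right not_is_unit_0)
qed


section \<open>The sorting permutation\<close>

lemma strict_decreasing_steps:
  fixes K :: "nat \<Rightarrow> int"
  assumes "\<And>j. j \<in> {1..<n} \<Longrightarrow> K j > K (Suc j)" "1 \<le> i" "i < j" "j \<le> n"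
  shows "K i > K j"
proof -
  have "i < j \<Longrightarrow> j \<le> n \<Longrightarrow> K i > K j" for j
  proof (induction j)
    case (Suc j)
    then show ?case using assms(1)[of j] assms(2) by (cases "i = j") auto
  qed simp
  then show ?thesis using assms by blast
qed

text \<open>
  A permutation along which \<open>K\<close> decreases must put \<open>u\<close> at position
  \<open>card {v. K v \<ge> K u}\<close>, and this rank function is a permutation.
\<close>

lemma ex1_decreasing_permutation:
  fixes K :: "nat \<Rightarrow> int"
  assumes inj: "inj_on K {1..n}"
  shows "\<exists>!\<pi>. \<pi> permutes {1..n} \<and> (\<forall>j\<in>{1..<n}. K (\<pi> j) > K (\<pi> (Suc j)))"
proof -
  \<comment> \<open>Outside \<open>{1..n}\<close> the rank is the identity, as
    \<open>permutes\<close> demands.\<close>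
  define r where "r u = (if u \<in> {1..n} then card {v \<in> {1..n}. K v \<ge> K u} else u)" for u
  have r_mono: "r u < r v" if "u \<in> {1..n}" "v \<in> {1..n}" "K u > K v" for u v
  proof -
    have "{w \<in> {1..n}. K w \<ge> K u} \<subset> {w \<in> {1..n}. K w \<ge> K v}"
    proof (rule psubsetI)
      have "v \<in> {w \<in> {1..n}. K w \<ge> K v}" "v \<notin> {w \<in> {1..n}. K w \<ge> K u}"
        using that by auto
      then show "{w \<in> {1..n}. K w \<ge> K u} \<noteq> {w \<in> {1..n}. K w \<ge> K v}" by blast
    qed (use that in auto)
    then have "card {w \<in> {1..n}. K w \<ge> K u} < card {w \<in> {1..n}. K w \<ge> K v}"
      by (intro psubset_card_mono) auto
    then show ?thesis unfolding r_def using that by simp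
  qed
  have r_inj: "inj_on r {1..n}"
  proof (rule inj_onI)
    fix u v assume uv: "u \<in> {1..n}" "v \<in> {1..n}" "r u = r v"
    then have "K u = K v" using r_mono[of u v] r_mono[of v u] by (cases "K u" "K v" rule: linorder_cases) auto
    with inj uv show "u = v" by (auto dest: inj_onD)
  qed
  have r_in: "r u \<in> {1..n}" if "u \<in> {1..n}" for u
  proof -
    have "card {v \<in> {1..n}. K v \<ge> K u} \<le> card {1..n}" by (intro card_mono) auto
    moreover have "card {v \<in> {1..n}. K v \<ge> K u} > 0" using that by (subst card_gt_0_iff) auto
    ultimately show ?thesis using that by (simp add: r_def)
  qed
  have "r ` {1..n} = {1..n}"
    using r_in r_inj by (intro endo_inj_surj) auto
  then have "bij_betw r {1..n} {1..n}" using r_inj by (simp add: bij_betw_def)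
  then have r_perm: "r permutes {1..n}"
    by (rule bij_imp_permutes) (simp only: r_def if_False)
  show ?thesis
  proof (rule ex1I[of _ "inv r"], intro conjI ballI)
    show p: "inv r permutes {1..n}" using r_perm by (rule permutes_inv)
    fix j assume j: "j \<in> {1..<n}"
    have in': "inv r j \<in> {1..n}" "inv r (Suc j) \<in> {1..n}"
      using j permutes_in_image[OF p] by auto
    have eq: "r (inv r j) = j" "r (inv r (Suc j)) = Suc j"
      using r_perm by (simp_all add: permutes_inverses)
    have "\<not> K (inv r j) < K (inv r (Suc j))" "K (inv r j) \<noteq> K (inv r (Suc j))"
      using r_mono[OF in'(2,1)] eq inj in' by (auto dest: inj_onD)
    then show "K (inv r j) > K (inv r (Suc j))" by linarith
  next
    fix \<pi> assume \<pi>: "\<pi> permutes {1..n} \<and> (\<forall>j\<in>{1..<n}. K (\<pi> j) > K (\<pi> (Suc j)))"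
    have dec: "K (\<pi> i) > K (\<pi> j)" if "1 \<le> i" "i < j" "j \<le> n" for i j
      using strict_decreasing_steps[of n "\<lambda>j. K (\<pi> j)" i j] \<pi> that by blast
    have "r (\<pi> j) = j" for j
    proof (cases "j \<in> {1..n}")
      case True
      \<comment> \<open>Along a decreasing arrangement the keys at least \<open>K (\<pi> j)\<close>
        are those in the first \<open>j\<close> positions, so the rank of \<open>\<pi> j\<close> is
        \<open>j\<close>.\<close>
      have "{v \<in> {1..n}. K v \<ge> K (\<pi> j)} = \<pi> ` {1..j}"
      proof (intro equalityI subsetI)
        fix v assume v: "v \<in> {v \<in> {1..n}. K v \<ge> K (\<pi> j)}"
        then obtain i where i: "i \<in> {1..n}" "v = \<pi> i"
          using permutes_image[of \<pi> "{1..n}"] \<pi> by blast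
        with dec[of j i] v True have "i \<le> j" by fastforce
        with i show "v \<in> \<pi> ` {1..j}" by auto
      next
        fix v assume "v \<in> \<pi> ` {1..j}"
        then obtain i where i: "i \<in> {1..j}" "v = \<pi> i" by blast
        then have "K v \<ge> K (\<pi> j)" using dec[of i j] True by (cases "i = j") auto
        moreover have "v \<in> {1..n}" using i True permutes_in_image[of \<pi> "{1..n}" i] \<pi> by auto
        ultimately show "v \<in> {v \<in> {1..n}. K v \<ge> K (\<pi> j)}" by blast
      qed
      moreover have "card (\<pi> ` {1..j}) = j"
        using \<pi> by (subst card_image) (auto intro: permutes_inj_on)
      ultimately show ?thesis using True permutes_in_image[of \<pi> "{1..n}" j] \<pi> by (simp add: r_def)
    next
      case False
      then have "\<pi> j = j" using \<pi> by (blast intro: permutes_not_in)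
      with False show ?thesis by (simp only: r_def if_False)
    qed
    then have "inv r (r (\<pi> j)) = inv r j" for j by simp
    then show "\<pi> = inv r" using r_perm by (auto simp: permutes_inverses fun_eq_iff)
  qed
qed

text \<open>The strictness required at \<open>j\<close> depends on \<open>\<pi>\<close> itself. An
  injective key removes this circularity: a tie may stay at \<open>j\<close> only if the index
  increases there, that is, if \<open>j\<close> is not a descent.\<close>

lemma ex1_sorting_permutation:
  fixes l :: "nat \<Rightarrow> nat"
  shows "\<exists>!\<pi>. \<pi> permutes {1..n} \<and>
    (\<forall>j\<in>{1..<n}. l (\<pi> j) \<ge> l (\<pi> (Suc j)) + (if j \<in> descent_set n \<pi> then 1 else 0))"
proof -
  \<comment> \<open>encodes the lexicographic order on pairs (value descending, index ascending)\<close>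
  define K where "K u = int (l u) * int (n + 1) - int u" for u
  \<comment> \<open>The factor \<open>n + 1\<close> exceeds every difference of two indices, so the
    index decides only between equal values.\<close>
  have K_iff: "K u > K v \<longleftrightarrow> l u \<ge> l v + (if u > v then 1 else 0)"
    if uv: "u \<in> {1..n}" "v \<in> {1..n}" "u \<noteq> v" for u v
  proof -
    consider "l u \<ge> l v + 1" | "l u = l v" | "l v \<ge> l u + 1" by linarith
    then show ?thesis
    proof cases
      case 1
      then have "int (l u) * int (n + 1) \<ge> (int (l v) + 1) * int (n + 1)"
        by (intro mult_right_mono) auto
      then have "K u > K v" using uv by (simp add: K_def algebra_simps)
      with 1 show ?thesis by simp
    next
      case 2
      then show ?thesis using uv by (auto simp: K_def)
    next
      case 3
      then have "int (l v) * int (n + 1) \<ge> (int (l u) + 1) * int (n + 1)"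
        by (intro mult_right_mono) auto
      then have "K v > K u" using uv by (simp add: K_def algebra_simps)
      with 3 show ?thesis by simp
    qed
  qed
  have "inj_on K {1..n}"
  proof (rule inj_onI, rule ccontr)
    fix u v assume "u \<in> {1..n}" "v \<in> {1..n}" "K u = K v" "u \<noteq> v"
    then show False using K_iff[of u v] K_iff[of v u] by (auto split: if_splits)
  qed
  then have ex1: "\<exists>!\<pi>. \<pi> permutes {1..n} \<and> (\<forall>j\<in>{1..<n}. K (\<pi> j) > K (\<pi> (Suc j)))"
    by (rule ex1_decreasing_permutation)
  have "(K (\<pi> j) > K (\<pi> (Suc j))) \<longleftrightarrow>
      l (\<pi> j) \<ge> l (\<pi> (Suc j)) + (if j \<in> descent_set n \<pi> then 1 else 0)"
    if "\<pi> permutes {1..n}" "j \<in> {1..<n}" for \<pi> j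
  proof -
    have "\<pi> j \<noteq> \<pi> (Suc j)" using permutes_inj[OF that(1)] by (auto dest: injD)
    moreover have "\<pi> j \<in> {1..n}" "\<pi> (Suc j) \<in> {1..n}"
      using that permutes_in_image[OF that(1)] by auto
    ultimately show ?thesis using K_iff that(2) by (simp add: descent_set_def)
  qed
  then have "(\<lambda>\<pi>. \<pi> permutes {1..n} \<and> (\<forall>j\<in>{1..<n}. K (\<pi> j) > K (\<pi> (Suc j)))) =
    (\<lambda>\<pi>. \<pi> permutes {1..n} \<and>
      (\<forall>j\<in>{1..<n}. l (\<pi> j) \<ge> l (\<pi> (Suc j)) + (if j \<in> descent_set n \<pi> then 1 else 0)))"
    by (intro ext conj_cong ball_cong) auto
  with ex1 show ?thesis by simp
qed

text \<open>Exchange argument: \<open>{1..j} - T\<close> and \<open>T - {1..j}\<close> have equally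
  many elements, and \<open>a j\<close> bounds the values of \<open>a\<close> on the first set from
  above and on the second from below.\<close>

lemma sum_initial_segment_le:
  fixes a :: "nat \<Rightarrow> int"
  assumes mono: "mono_on {1..n} a" and T: "T \<subseteq> {1..n}" "card T = j"
  shows "(\<Sum>k=1..j. a k) \<le> (\<Sum>k\<in>T. a k)"
proof (cases "j = 0")
  case True
  then show ?thesis using T finite_subset[OF T(1)] by simp
next
  case False
  let ?J = "{1..j}"
  have fin: "finite T" using T(1) by (rule finite_subset) simp
  have jn: "j \<le> n" using card_mono[OF _ T(1)] T(2) by simp
  have card: "card (?J - T) = card (T - ?J)"
    using T(2) fin card_Diff_subset_Int[of ?J T] card_Diff_subset_Int[of T ?J]
    by (simp add: Int_commute)
  have "(\<Sum>k\<in>?J - T. a k) \<le> (\<Sum>k\<in>?J - T. a j)"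
    using jn by (intro sum_mono mono_onD[OF mono]) auto
  also have "\<dots> = (\<Sum>k\<in>T - ?J. a j)" using card by simp
  also have "\<dots> \<le> (\<Sum>k\<in>T - ?J. a k)"
    using jn T(1) False by (intro sum_mono mono_onD[OF mono]) auto
  finally have "(\<Sum>k\<in>?J - T. a k) \<le> (\<Sum>k\<in>T - ?J. a k)" .
  moreover have "(\<Sum>k\<in>?J. a k) = (\<Sum>k\<in>?J \<inter> T. a k) + (\<Sum>k\<in>?J - T. a k)"
    by (rule sum.Int_Diff) simp
  moreover have "(\<Sum>k\<in>T. a k) = (\<Sum>k\<in>?J \<inter> T. a k) + (\<Sum>k\<in>T - ?J. a k)"
    using sum.Int_Diff[OF fin, of a ?J] by (simp add: Int_commute)
  ultimately show ?thesis by linarith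
qed


section \<open>Decomposition of the constraint set\<close>

text \<open>Column \<open>j < n\<close> is the indicator of \<open>{1..j}\<close> minus the constant
  \<open>a 1 + ... + a j\<close>. Weighting by \<open>a\<close>, whose total is \<open>1\<close>,
  makes the two parts cancel.\<close>

lemma sum_a_b_entry:
  assumes "(\<Sum>i=1..n. a i) = 1" "j \<in> {1..n}"
  shows "(\<Sum>i=1..n. a i * b_entry n a i j) = (if j = n then 1 else 0)"
proof (cases "j = n")
  case True
  then show ?thesis using assms by (simp add: b_entry_def)
next
  case False
  let ?A = "\<Sum>k=1..j. a k"
  have "(\<Sum>i=1..n. a i * b_entry n a i j) =
      (\<Sum>i=1..n. (if i \<le> j then a i else 0) - a i * ?A)"
    using False by (intro sum.cong) (auto simp: b_entry_def algebra_simps)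
  also have "\<dots> = (\<Sum>i=1..n. if i \<in> {1..j} then a i else 0) - (\<Sum>i=1..n. a i) * ?A"
    unfolding sum_subtractf sum_distrib_right by (auto intro!: sum.cong)
  also have "(\<Sum>i=1..n. if i \<in> {1..j} then a i else 0) = (\<Sum>i\<in>{1..n} \<inter> {1..j}. a i)"
    by (rule sum.inter_restrict[symmetric]) simp
  also have "{1..n} \<inter> {1..j} = {1..j}" using assms(2) by auto
  finally show ?thesis using False assms(1) by simp
qed

text \<open>Among the columns only column \<open>i\<close> changes between rows \<open>i\<close> and
  \<open>i + 1\<close>, where it drops by \<open>1\<close>; the \<open>a\<close>-weighted sum
  annihilates every column but the last. So differences and weighted sum read off the
  coefficients.\<close>

lemma b_entry_coordinates:
  fixes a x c :: "nat \<Rightarrow> int"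
  assumes n: "n \<ge> 1" and total: "(\<Sum>i=1..n. a i) = 1"
    and x: "\<And>i. i \<in> {1..n} \<Longrightarrow> x i = (\<Sum>j=1..n. c j * b_entry n a i j)"
  shows "i \<in> {1..<n} \<Longrightarrow> c i = x i - x (Suc i)"
    and "c n = (\<Sum>j=1..n. a j * x j)"
proof -
  assume i: "i \<in> {1..<n}"
  then have "x i - x (Suc i) = (\<Sum>j=1..n. c j * (b_entry n a i j - b_entry n a (Suc i) j))"
    by (simp add: x sum_subtractf right_diff_distrib)
  also have "\<dots> = (\<Sum>j=1..n. if j = i then c j else 0)"
    using i by (intro sum.cong) (auto simp: b_entry_def)
  also have "\<dots> = c i" using i by simp
  finally show "c i = x i - x (Suc i)" ..
next
  have "(\<Sum>i=1..n. a i * x i) = (\<Sum>i=1..n. \<Sum>j=1..n. c j * (a i * b_entry n a i j))"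
    by (intro sum.cong) (auto simp: x sum_distrib_left mult_ac)
  also have "\<dots> = (\<Sum>j=1..n. c j * (\<Sum>i=1..n. a i * b_entry n a i j))"
    by (subst sum.swap) (simp add: sum_distrib_left)
  also have "\<dots> = (\<Sum>j=1..n. if j = n then c j else 0)"
    by (intro sum.cong) (use sum_a_b_entry[OF total] in auto)
  also have "\<dots> = c n" using n by simp
  finally show "c n = (\<Sum>j=1..n. a j * x j)" ..
qed

text \<open>The combination \<open>y\<close> of the columns has the same consecutive differences as
  \<open>x\<close>, so \<open>x - y\<close> is constant on \<open>{1..n}\<close>. The weighted sums
  also agree, and as the weights add up to \<open>1\<close> the constant is
  \<open>0\<close>.\<close>

lemma b_entry_expansion:
  fixes a x c :: "nat \<Rightarrow> int"
  assumes n: "n \<ge> 1" and total: "(\<Sum>i=1..n. a i) = 1"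
    and diff: "\<And>i. i \<in> {1..<n} \<Longrightarrow> c i = x i - x (Suc i)"
    and last: "c n = (\<Sum>j=1..n. a j * x j)"
    and i: "i \<in> {1..n}"
  shows "x i = (\<Sum>j=1..n. c j * b_entry n a i j)"
proof -
  define y where "y i = (\<Sum>j=1..n. c j * b_entry n a i j)" for i
  note y = b_entry_coordinates[OF n total, of y c, OF y_def]
  have const: "x i - y i = x 1 - y 1" if "1 \<le> i" "i \<le> n" for i
    using that
  proof (induction i rule: nat_induct_at_least)
    case (Suc i)
    then show ?case using diff[of i] y(1)[of i] by auto
  qed simp
  have "0 = (\<Sum>j=1..n. a j * (x j - y j))"
    using y(2) last by (simp add: right_diff_distrib sum_subtractf)
  also have "\<dots> = (\<Sum>j=1..n. a j * (x 1 - y 1))"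
    by (intro sum.cong refl) (metis const atLeastAtMost_iff)
  also have "\<dots> = x 1 - y 1" using total by (simp flip: sum_distrib_right)
  finally show ?thesis using const[of i] i by (simp add: y_def)
qed

section \<open>Exponent vectors of the generators\<close>

definition z_exponent :: "nat \<Rightarrow> (nat \<Rightarrow> int) \<Rightarrow> (nat \<Rightarrow> nat) \<Rightarrow> nat \<Rightarrow> (nat \<Rightarrow>\<^sub>0 nat)"
  where "z_exponent n a \<pi> j = (\<Sum>i=1..n. Poly_Mapping.single (\<pi> i) (nat (b_entry n a i j)))"

lemma z_monomial_eq: "z_monomial n a \<pi> j = mfps_of_exponents {z_exponent n a \<pi> j}"
  by (simp add: z_monomial_def z_exponent_def mfps_var_power prod_mfps_monom)

lemma lookup_z_exponent:
  assumes "\<pi> permutes {1..n}" "i \<in> {1..n}"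
  shows "Poly_Mapping.lookup (z_exponent n a \<pi> j) (\<pi> i) = nat (b_entry n a i j)"
proof -
  have "Poly_Mapping.lookup (z_exponent n a \<pi> j) (\<pi> i) =
      (\<Sum>k=1..n. if k = i then nat (b_entry n a k j) else 0)"
    unfolding z_exponent_def lookup_sum
    using permutes_inj[OF assms(1)]
    by (intro sum.cong) (auto simp: lookup_single when_def dest: injD)
  with assms(2) show ?thesis by simp
qed

lemma lookup_z_exponent_outside:
  assumes "\<pi> permutes {1..n}" "k \<notin> {1..n}"
  shows "Poly_Mapping.lookup (z_exponent n a \<pi> j) k = 0"
proof -
  have "\<pi> i \<noteq> k" if "i \<in> {1..n}" for i
    using that assms permutes_in_image[OF assms(1), of i] by auto
  then show ?thesis
    unfolding z_exponent_def lookup_sum by (auto simp: lookup_single when_def)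
qed

text \<open>The degree is a column sum of \<open>b_entry\<close>, computed over the integers: column
  \<open>j < n\<close> contributes \<open>1\<close> for each row up to \<open>j\<close> and
  subtracts the partial sum of \<open>a\<close> in all \<open>n\<close> rows.\<close>

lemma degree_z_exponent:
  assumes mono: "mono_on {1..n} a" and total: "(\<Sum>i=1..n. a i) = 1"
    and \<pi>: "\<pi> permutes {1..n}" and j: "j \<in> {1..n}"
  shows "(\<Sum>i=1..n. Poly_Mapping.lookup (z_exponent n a \<pi> j) i) =
    (if j = n then n else nat (q_exponent n a j))"
proof -
  let ?e = "Poly_Mapping.lookup (z_exponent n a \<pi> j)" and ?A = "\<Sum>k=1..j. a k"
  have "(\<Sum>i=1..n. ?e i) = (\<Sum>i=1..n. ?e (\<pi> i))"
    using sum.permute[OF \<pi>, of ?e] by (simp add: o_def)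
  also have "\<dots> = (\<Sum>i=1..n. nat (b_entry n a i j))"
    by (intro sum.cong) (auto simp: lookup_z_exponent[OF \<pi>])
  finally have "int (\<Sum>i=1..n. ?e i) = (\<Sum>i=1..n. b_entry n a i j)"
    using b_entry_nonneg[OF mono total] j by simp
  also have "\<dots> = (if j = n then int n else q_exponent n a j)"
  proof (cases "j = n")
    case False
    then have "(\<Sum>i=1..n. b_entry n a i j) = (\<Sum>i=1..n. (if i \<in> {1..j} then 1 else 0) - ?A)"
      by (intro sum.cong) (auto simp: b_entry_def)
    also have "\<dots> = (\<Sum>i\<in>{1..n} \<inter> {1..j}. 1) - int n * ?A"
      by (subst sum.inter_restrict) (simp_all add: sum_subtractf)
    also have "{1..n} \<inter> {1..j} = {1..j}" using j by auto
    finally show ?thesis using False by (simp add: q_exponent_def)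
  qed (simp add: b_entry_def)
  finally show ?thesis by (metis nat_int)
qed

section \<open>The cones attached to the permutations\<close>

context
  fixes n :: nat and a :: "nat \<Rightarrow> int"
  assumes n: "n \<ge> 1" and mono: "mono_on {1..n} a" and total: "(\<Sum>i=1..n. a i) = 1"
begin

text \<open>Nonnegativity of the entries makes \<open>nat\<close> exact, which passes from natural
  exponents to the integer identities for \<open>b_entry\<close>.\<close>

lemma z_exponent_combination:
  assumes \<pi>: "\<pi> permutes {1..n}" and i: "i \<in> {1..n}"
  shows "int (\<Sum>j=1..n. c j * Poly_Mapping.lookup (z_exponent n a \<pi> j) (\<pi> i)) =
    (\<Sum>j=1..n. int (c j) * b_entry n a i j)"
  unfolding of_nat_sum
  by (intro sum.cong) (use b_entry_nonneg[OF mono total] in \<open>auto simp: lookup_z_exponent[OF \<pi> i]\<close>)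

lemma free_z_exponent:
  assumes \<pi>: "\<pi> permutes {1..n}"
  shows "free_generators {1..n} (z_exponent n a \<pi>)"
  unfolding free_generators_def
proof (intro allI impI ballI)
  fix c d :: "nat \<Rightarrow> nat" and j
  assume eq: "\<forall>k. (\<Sum>j=1..n. c j * Poly_Mapping.lookup (z_exponent n a \<pi> j) k) =
      (\<Sum>j=1..n. d j * Poly_Mapping.lookup (z_exponent n a \<pi> j) k)" and j: "j \<in> {1..n}"
  define x where "x i = (\<Sum>j=1..n. int (c j) * b_entry n a i j)" for i
  have xd: "x i = (\<Sum>j=1..n. int (d j) * b_entry n a i j)" if "i \<in> {1..n}" for i
    using eq z_exponent_combination[OF \<pi> that] unfolding x_def by metis
  note C = b_entry_coordinates[OF n total, of x "\<lambda>j. int (c j)", OF x_def]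
  note D = b_entry_coordinates[OF n total, of x "\<lambda>j. int (d j)", OF xd]
  show "c j = d j"
  proof (cases "j = n")
    case True
    then show ?thesis using C(2) D(2) by simp
  next
    case False
    then have "j \<in> {1..<n}" using j by auto
    then show ?thesis using C(1)[of j] D(1)[of j] by simp
  qed
qed

text \<open>The coefficients of \<open>l\<close> are forced to be its consecutive differences along
  \<open>\<pi>\<close> and its \<open>a\<close>-weighted sum. These are integers, so only their
  signs and the positivity at descents remain as conditions.\<close>

lemma mem_half_open_cone_z_exponent_iff:
  assumes \<pi>: "\<pi> permutes {1..n}"
  shows "l \<in> half_open_cone (descent_set n \<pi>) {1..n} (z_exponent n a \<pi>) \<longleftrightarrow>
    Poly_Mapping.keys l \<subseteq> {1..n} \<and>
    (\<forall>j\<in>{1..<n}. Poly_Mapping.lookup l (\<pi> j) \<ge> Poly_Mapping.lookup l (\<pi> (Suc j)) +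
      (if j \<in> descent_set n \<pi> then 1 else 0)) \<and>
    (\<Sum>j=1..n. a j * int (Poly_Mapping.lookup l (\<pi> j))) \<ge> 0"
    (is "_ \<longleftrightarrow> ?keys \<and> ?steps \<and> ?sum")
proof
  assume "l \<in> half_open_cone (descent_set n \<pi>) {1..n} (z_exponent n a \<pi>)"
  then obtain c where c: "\<And>j. j \<in> {1..n} \<Longrightarrow> j \<in> descent_set n \<pi> \<Longrightarrow> 1 \<le> c j"
    and l: "\<And>k. Poly_Mapping.lookup l k =
      (\<Sum>j=1..n. c j * Poly_Mapping.lookup (z_exponent n a \<pi> j) k)"
    by (rule half_open_coneE) blast
  define x where "x i = int (Poly_Mapping.lookup l (\<pi> i))" for i
  have x: "x i = (\<Sum>j=1..n. int (c j) * b_entry n a i j)" if "i \<in> {1..n}" for i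
    unfolding x_def l by (rule z_exponent_combination[OF \<pi> that])
  note C = b_entry_coordinates[OF n total, of x "\<lambda>j. int (c j)", OF x]
  have "Poly_Mapping.lookup l k = 0" if "k \<notin> {1..n}" for k
    unfolding l using lookup_z_exponent_outside[OF \<pi> that] by simp
  then have ?keys by (metis in_keys_iff subsetI)
  moreover have ?steps
  proof
    fix j assume j: "j \<in> {1..<n}"
    then show "Poly_Mapping.lookup l (\<pi> j) \<ge> Poly_Mapping.lookup l (\<pi> (Suc j)) +
      (if j \<in> descent_set n \<pi> then 1 else 0)"
      using C(1)[of j] c[of j] unfolding x_def by auto
  qed
  moreover have ?sum using C(2) unfolding x_def by simp
  ultimately show "?keys \<and> ?steps \<and> ?sum" by blast
next
  assume R: "?keys \<and> ?steps \<and> ?sum"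
  define x where "x i = int (Poly_Mapping.lookup l (\<pi> i))" for i
  define c where "c j = (if j = n then \<Sum>j=1..n. a j * x j else x j - x (Suc j))" for j
  have c_nonneg: "c j \<ge> 0" if "j \<in> {1..n}" for j
  proof (cases "j = n")
    case False
    then have "j \<in> {1..<n}" using that by auto
    with False R show ?thesis unfolding c_def x_def by force
  qed (use R in \<open>simp add: c_def x_def\<close>)
  have x: "x i = (\<Sum>j=1..n. c j * b_entry n a i j)" if "i \<in> {1..n}" for i
    by (rule b_entry_expansion[OF n total _ _ that]) (auto simp: c_def)
  show "l \<in> half_open_cone (descent_set n \<pi>) {1..n} (z_exponent n a \<pi>)"
  proof (rule half_open_coneI[where c = "\<lambda>j. nat (c j)"])
    \<comment> \<open>Since \<open>n\<close> is never a descent, the coefficient in question is a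
      difference and not the weighted sum.\<close>
    fix j assume "j \<in> {1..n}" "j \<in> descent_set n \<pi>"
    then have "j \<in> {1..<n}" "j \<in> descent_set n \<pi>" by (auto simp: descent_set_def)
    then show "1 \<le> nat (c j)" using R unfolding c_def x_def by force
  next
    fix k
    show "Poly_Mapping.lookup l k =
        (\<Sum>j=1..n. nat (c j) * Poly_Mapping.lookup (z_exponent n a \<pi> j) k)"
    proof (cases "k \<in> {1..n}")
      case True
      then obtain i where i: "i \<in> {1..n}" "k = \<pi> i"
        using permutes_image[OF \<pi>] by blast
      have "int (Poly_Mapping.lookup l k) = (\<Sum>j=1..n. int (nat (c j)) * b_entry n a i j)"
        using x[OF i(1)] c_nonneg by (simp add: x_def i(2))
      then show ?thesis
        using z_exponent_combination[OF \<pi> i(1), of "\<lambda>j. nat (c j)"] i(2)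
        by (metis of_nat_eq_iff)
    next
      case False
      then have "Poly_Mapping.lookup l k = 0"
        using R in_keys_iff by (metis subsetD)
      then show ?thesis using lookup_z_exponent_outside[OF \<pi> False] by simp
    qed
  qed
qed

text \<open>For \<open>j < n\<close> the weighted sum equals the sum of \<open>a\<close> over some
  \<open>j\<close> indices minus the sum over the first \<open>j\<close>, which is nonnegative for
  increasing \<open>a\<close>. For \<open>j = n\<close> it is the total \<open>1\<close>.\<close>

lemma z_exponent_constraint:
  assumes \<pi>: "\<pi> permutes {1..n}" and \<sigma>: "\<sigma> permutes {1..n}" and j: "j \<in> {1..n}"
  shows "(\<Sum>i=1..n. a i * int (Poly_Mapping.lookup (z_exponent n a \<pi> j) (\<sigma> i))) \<ge> 0"
proof -
  \<comment> \<open>Position \<open>i\<close> of \<open>\<sigma>\<close> holds the entry that the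
    generator has at position \<open>\<tau> i\<close> of \<open>\<pi>\<close>.\<close>
  define \<tau> where "\<tau> = inv \<pi> \<circ> \<sigma>"
  have \<tau>: "\<tau> permutes {1..n}"
    unfolding \<tau>_def using \<pi> \<sigma> by (intro permutes_compose permutes_inv)
  have look: "int (Poly_Mapping.lookup (z_exponent n a \<pi> j) (\<sigma> i)) = b_entry n a (\<tau> i) j"
    if "i \<in> {1..n}" for i
  proof -
    have "\<sigma> i = \<pi> (\<tau> i)" unfolding \<tau>_def using \<pi> by (simp add: permutes_inverses)
    moreover have "\<tau> i \<in> {1..n}" using permutes_in_image[OF \<tau>] that by blast
    ultimately show ?thesis
      using lookup_z_exponent[OF \<pi>, of "\<tau> i" a j] b_entry_nonneg[OF mono total, of j] j by simp
  qed
  have "(\<Sum>i=1..n. a i * b_entry n a (\<tau> i) j) \<ge> 0"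
  proof (cases "j = n")
    case True
    then show ?thesis using total by (simp add: b_entry_def)
  next
    case False
    let ?A = "\<Sum>k=1..j. a k"
    \<comment> \<open>The positions where the entry is \<open>1 - ?A\<close>; at all others it is
      \<open>- ?A\<close>.\<close>
    define T where "T = {i \<in> {1..n}. \<tau> i \<in> {1..j}}"
    have "{1..j} \<subseteq> \<tau> ` {1..n}"
      unfolding permutes_image[OF \<tau>] using j by auto
    then have "\<tau> ` T = {1..j}" unfolding T_def by blast
    moreover have "card (\<tau> ` T) = card T"
      using \<tau> by (intro card_image) (rule permutes_inj_on)
    ultimately have "card T = j" by simp
    then have le: "?A \<le> (\<Sum>i\<in>T. a i)"
      by (intro sum_initial_segment_le[OF mono]) (auto simp: T_def)
    have "(\<Sum>i=1..n. a i * b_entry n a (\<tau> i) j) =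
        (\<Sum>i=1..n. (if \<tau> i \<in> {1..j} then a i else 0) - a i * ?A)"
      using False permutes_in_image[OF \<tau>]
      by (intro sum.cong) (force simp: b_entry_def algebra_simps)+
    also have "\<dots> = (\<Sum>i\<in>T. a i) - (\<Sum>i=1..n. a i) * ?A"
      unfolding T_def sum_subtractf sum_distrib_right by (subst sum.inter_filter) simp_all
    finally show ?thesis using le total by simp
  qed
  then show ?thesis using look by simp
qed

text \<open>A vector in the constraint set satisfies in particular the constraint of its own sorting
  permutation, which places it in that cone. Conversely all constraints are linear, so it suffices
  that every generator satisfies them.\<close>

lemma constraint_set_decomposition:
  "constraint_set n a =
    (\<Union>\<pi>\<in>{\<pi>. \<pi> permutes {1..n}}. half_open_cone (descent_set n \<pi>) {1..n} (z_exponent n a \<pi>))"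
proof (intro equalityI subsetI)
  fix l assume l: "l \<in> constraint_set n a"
  obtain \<pi> where \<pi>: "\<pi> permutes {1..n}" and steps: "\<forall>j\<in>{1..<n}. Poly_Mapping.lookup l (\<pi> j) \<ge>
      Poly_Mapping.lookup l (\<pi> (Suc j)) + (if j \<in> descent_set n \<pi> then 1 else 0)"
    using ex1_sorting_permutation[of n "Poly_Mapping.lookup l"] by blast
  have "l \<in> half_open_cone (descent_set n \<pi>) {1..n} (z_exponent n a \<pi>)"
    using l \<pi> steps unfolding mem_half_open_cone_z_exponent_iff[OF \<pi>] constraint_set_def by blast
  with \<pi> show "l \<in> (\<Union>\<pi>\<in>{\<pi>. \<pi> permutes {1..n}}.
      half_open_cone (descent_set n \<pi>) {1..n} (z_exponent n a \<pi>))" by blast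
next
  fix l assume "l \<in> (\<Union>\<pi>\<in>{\<pi>. \<pi> permutes {1..n}}.
      half_open_cone (descent_set n \<pi>) {1..n} (z_exponent n a \<pi>))"
  then obtain \<pi> where \<pi>: "\<pi> permutes {1..n}"
    and l: "l \<in> half_open_cone (descent_set n \<pi>) {1..n} (z_exponent n a \<pi>)" by blast
  from l obtain c where c: "\<And>k. Poly_Mapping.lookup l k =
      (\<Sum>j=1..n. c j * Poly_Mapping.lookup (z_exponent n a \<pi> j) k)"
    by (rule half_open_coneE) blast
  have "(\<Sum>i=1..n. a i * int (Poly_Mapping.lookup l (\<sigma> i))) \<ge> 0" if \<sigma>: "\<sigma> permutes {1..n}" for \<sigma>
  proof -
    let ?e = "\<lambda>j i. int (Poly_Mapping.lookup (z_exponent n a \<pi> j) (\<sigma> i))"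
    have "(\<Sum>i=1..n. a i * int (Poly_Mapping.lookup l (\<sigma> i))) =
        (\<Sum>i=1..n. \<Sum>j=1..n. int (c j) * (a i * ?e j i))"
      by (simp add: c sum_distrib_left mult_ac)
    also have "\<dots> = (\<Sum>j=1..n. int (c j) * (\<Sum>i=1..n. a i * ?e j i))"
      by (subst sum.swap) (simp add: sum_distrib_left)
    also have "\<dots> \<ge> 0"
      by (rule sum_nonneg, rule mult_nonneg_nonneg) (simp, rule z_exponent_constraint[OF \<pi> \<sigma>])
    finally show ?thesis .
  qed
  moreover have "Poly_Mapping.keys l \<subseteq> {1..n}"
    using l mem_half_open_cone_z_exponent_iff[OF \<pi>] by blast
  ultimately show "l \<in> constraint_set n a" by (simp add: constraint_set_def)
qed

text \<open>Membership in a cone makes its permutation sort \<open>l\<close> with ties broken by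
  index, and only one permutation does so.\<close>

lemma disjoint_half_open_cones:
  "disjoint_family_on (\<lambda>\<pi>. half_open_cone (descent_set n \<pi>) {1..n} (z_exponent n a \<pi>))
     {\<pi>. \<pi> permutes {1..n}}"
  unfolding disjoint_family_on_def
proof (intro ballI impI, rule ccontr)
  fix \<pi> \<sigma>
  assume perms: "\<pi> \<in> {\<pi>. \<pi> permutes {1..n}}" "\<sigma> \<in> {\<pi>. \<pi> permutes {1..n}}" and "\<pi> \<noteq> \<sigma>"
    and "half_open_cone (descent_set n \<pi>) {1..n} (z_exponent n a \<pi>) \<inter>
      half_open_cone (descent_set n \<sigma>) {1..n} (z_exponent n a \<sigma>) \<noteq> {}"
  then obtain l where "l \<in> half_open_cone (descent_set n \<pi>) {1..n} (z_exponent n a \<pi>)"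
    "l \<in> half_open_cone (descent_set n \<sigma>) {1..n} (z_exponent n a \<sigma>)" by blast
  with perms have "\<pi> = \<sigma>"
    using ex1_sorting_permutation[of n "Poly_Mapping.lookup l"]
    by (auto simp only: mem_half_open_cone_z_exponent_iff mem_Collect_eq)
  with \<open>\<pi> \<noteq> \<sigma>\<close> show False by blast
qed

lemma mfps_diagonal_z_monomial:
  assumes "\<pi> permutes {1..n}" "j \<in> {1..n}"
  shows "mfps_diagonal n (z_monomial n a \<pi> j) =
    fps_X ^ (if j = n then n else nat (q_exponent n a j))"
proof -
  have "Poly_Mapping.keys (z_exponent n a \<pi> j) \<subseteq> {1..n}"
    using lookup_z_exponent_outside[OF assms(1)] by (metis in_keys_iff subsetI)
  then show ?thesis
    unfolding z_monomial_eq
    by (simp only: mfps_diagonal_monom degree_z_exponent[OF mono total assms])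
qed

end


section \<open>Summation over the permutations and specialization to one variable\<close>

theorem theorem1:
  fixes n :: nat and a :: "nat \<Rightarrow> int"
  assumes "n \<ge> 1"
    and "mono_on {1..n} a"
    and "(\<Sum>i=1..n. a i) = 1"
  shows "(F_series n a :: (nat, 'a :: field) mfps) =
           (\<Sum>\<pi> | \<pi> permutes {1..n}.
             (\<Prod>j\<in>descent_set n \<pi>. z_monomial n a \<pi> j) /
             (\<Prod>j=1..n. 1 - z_monomial n a \<pi> j)) \<and>
         mfps_diagonal n (F_series n a :: (nat, 'a) mfps) =
           (\<Sum>\<pi> | \<pi> permutes {1..n}. \<Prod>j\<in>descent_set n \<pi>. fps_X ^ nat (q_exponent n a j)) /
           ((1 - fps_X ^ n) * (\<Prod>j=1..n-1. 1 - fps_X ^ nat (q_exponent n a j)))"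
proof
  let ?P = "{\<pi>. \<pi> permutes {1..n}}"
  let ?N = "\<lambda>\<pi>. \<Prod>j\<in>descent_set n \<pi>. z_monomial n a \<pi> j :: (nat, 'a) mfps"
  let ?D = "\<lambda>\<pi>. \<Prod>j=1..n. 1 - z_monomial n a \<pi> j :: (nat, 'a) mfps"
  let ?d = "(1 - fps_X ^ n) * (\<Prod>j=1..n-1. 1 - fps_X ^ nat (q_exponent n a j)) :: 'a fps"
  let ?q = "\<lambda>\<pi>. \<Prod>j\<in>descent_set n \<pi>. fps_X ^ nat (q_exponent n a j) :: 'a fps"
  have D_sub: "descent_set n \<pi> \<subseteq> {1..n}" for \<pi> by (auto simp: descent_set_def)
  have "F_series n a = (\<Sum>\<pi>\<in>?P. mfps_of_exponents
      (half_open_cone (descent_set n \<pi>) {1..n} (z_exponent n a \<pi>)) :: (nat, 'a) mfps)"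
    unfolding F_series_def constraint_set_decomposition[OF assms]
    by (intro mfps_of_exponents_UN_disjoint disjoint_half_open_cones[OF assms])
      (simp add: finite_permutations)
  also have "\<dots> = (\<Sum>\<pi>\<in>?P. ?N \<pi> / ?D \<pi>)"
    unfolding z_monomial_eq
    by (intro sum.cong refl half_open_cone_series(1) D_sub free_z_exponent[OF assms]) simp_all
  finally show F: "F_series n a = (\<Sum>\<pi>\<in>?P. ?N \<pi> / ?D \<pi>)" .
  have unit: "\<exists>h. ?D \<pi> * h = 1" if "\<pi> \<in> ?P" for \<pi>
    unfolding z_monomial_eq
    using half_open_cone_series(2)[OF _ free_z_exponent[OF assms] D_sub] that by simp
  \<comment> \<open>After the substitution the denominator no longer depends on
    \<open>\<pi>\<close>. The factor for \<open>j = n\<close> is split off because its exponent is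
    \<open>n\<close>.\<close>
  have diag_D: "mfps_diagonal n (?D \<pi>) = ?d" if "\<pi> \<in> ?P" for \<pi>
  proof -
    have "mfps_diagonal n (?D \<pi>) =
        (\<Prod>j=1..n. 1 - fps_X ^ (if j = n then n else nat (q_exponent n a j)))"
      unfolding mfps_diagonal_prod mfps_diagonal_diff mfps_diagonal_one
      using that by (intro prod.cong refl) (simp only: mfps_diagonal_z_monomial[OF assms] mem_Collect_eq)
    also have "\<dots> = (\<Prod>j\<in>insert n {1..n-1}. 1 - fps_X ^ (if j = n then n else nat (q_exponent n a j)))"
      using assms(1) by (intro prod.cong) auto
    also have "\<dots> = ?d"
      using assms(1) by (subst prod.insert) (auto intro!: prod.cong arg_cong2[of _ _ _ _ "(*)"])
    finally show ?thesis .
  qed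
  have diag_N: "mfps_diagonal n (?N \<pi>) = ?q \<pi>" if "\<pi> \<in> ?P" for \<pi>
    unfolding mfps_diagonal_prod
    using that D_sub[of \<pi>]
    by (intro prod.cong refl, subst mfps_diagonal_z_monomial[OF assms]) (auto simp: descent_set_def)
  have "q_exponent n a j > 0" if "j \<in> {1..n-1}" for j
    using that by (intro q_exponent_pos[OF assms(2,3)]) auto
  \<comment> \<open>All exponents in \<open>?d\<close> are positive, so its constant term is
    \<open>1\<close>. Division by \<open>?d\<close> is then multiplication by its inverse and
    distributes over the sum.\<close>
  then have d0: "fps_nth ?d 0 \<noteq> 0"
    using assms(1) by (force simp: fps_nth_0_prod fps_X_power_nth)
  have "mfps_diagonal n (F_series n a :: (nat, 'a) mfps) = (\<Sum>\<pi>\<in>?P. ?q \<pi> / ?d)"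
    unfolding F mfps_diagonal_sum
    by (intro sum.cong refl) (simp only: mfps_diagonal_divide[OF unit] diag_N diag_D)
  also have "\<dots> = (\<Sum>\<pi>\<in>?P. ?q \<pi>) / ?d"
    unfolding fps_divide_unit[OF d0] sum_distrib_right ..
  finally show "mfps_diagonal n (F_series n a :: (nat, 'a) mfps) = (\<Sum>\<pi>\<in>?P. ?q \<pi>) / ?d" .
qed

end
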